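(* Let $A\in\mathbb{R}^{m\times n}$ have nonnegative entries with $w_j:=\sum_{i=1}^m A_{ij}>0$ for all $j=1,\dots,n$. Let $C\subset\mathbb{R}^n$ be a convex set with $C\cap\mathbb{R}^n_{>0}\neq\emptyset$, and assume that $C_\theta:=\{\theta\in\mathbb{R}^n: e^\theta\in C\}$ is closed and convex. Let $\mathcal{A}(\theta)=\sum_{i,j}A_{ij}e^{\theta_j}$. Let $\tilde\theta\in\mathbb{R}^n$, let $\theta^\star$ denote the Bregman projection $$\theta^\star=\operatorname*{arg\,min}_{\theta\in C_\theta}D_{\mathcal{A}}(\theta,\tilde\theta),$$ and define $x^\star=e^{\theta^\star}$, $\tilde x=e^{\tilde\theta}$, $\tilde w_j:=w_j\tilde x_j$ and $\phi(x)=-\sum_{j=1}^n\tilde w_j\log x_j$ for $x\in\mathbb{R}^n_{>0}$. Then solving the projection problem $\min_{\theta\in C_\theta}D_{\mathcal{A}}(\theta,\tilde\theta)$ is equivalent to the Bregman projection $$x^\star=\operatorname{Proj}_C^\phi(\tilde x):=\operatorname*{arg\,min}_{x\in C\cap\mathbb{R}^n_{>0}}D_\phi(x,\tilde x);$$ that is, $\theta^\star$ minimizes $D_{\mathcal{A}}(\cdot,\tilde\theta)$ over $C_\theta$ if and only if $x^\star=e^{\theta^\star}$ minimizes $D_\phi(\cdot,\tilde x)$ over $C\cap\mathbb{R}^n_{>0}$.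
   Context: Exponentials of vectors are componentwise. For a convex function $u$ differentiable on the interior of its domain, the Bregman divergence is $D_u(x,y)=u(x)-u(y)-\langle\nabla u(y),x-y\rangle$ for $x\in\operatorname{dom}u$, $y\in\operatorname{int}(\operatorname{dom}u)$. The domain of $\phi$ is $\mathbb{R}^n_{>0}$ (with $\phi=+\infty$ elsewhere). *)

theory Defs
  imports "HOL-Analysis.Analysis"
begin

definition gradient :: "('a::real_inner \<Rightarrow> real) \<Rightarrow> 'a \<Rightarrow> 'a" where
  "gradient f y = (THE D. GDERIV f y :> D)"

text \<open>
  Convex functions are extended-real-valued; the domain of \<open>u\<close> is the set where \<open>u\<close> is finite.
  The divergence is meant for \<open>y\<close> in the interior of that domain, where \<open>real_of_ereal \<circ> u\<close>
  coincides with \<open>u\<close> near \<open>y\<close> and \<open>u\<close> is assumed differentiable. There, the value at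
  a point \<open>x\<close> outside the domain is \<open>\<infinity>\<close>.
\<close>

definition bregman_div :: "('a::real_inner \<Rightarrow> ereal) \<Rightarrow> 'a \<Rightarrow> 'a \<Rightarrow> ereal" where
  "bregman_div u x y =
     u x - u y - ereal (gradient (\<lambda>z. real_of_ereal (u z)) y \<bullet> (x - y))"

text \<open>The arg min is the set of all minimizers; it is \<open>{z}\<close> iff \<open>z\<close> is the unique one.\<close>

definition bregman_argmin :: "('a::real_inner \<Rightarrow> ereal) \<Rightarrow> 'a set \<Rightarrow> 'a \<Rightarrow> 'a set" where
  "bregman_argmin u S y = {x. is_arg_min (\<lambda>z. bregman_div u z y) (\<lambda>z. z \<in> S) x}"

definition pos_orthant :: "(real ^ 'n) set" where
  "pos_orthant = {x. \<forall>j. 0 < x $ j}"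

definition vec_exp :: "real ^ 'n \<Rightarrow> real ^ 'n" where
  "vec_exp \<theta> = (\<chi> j. exp (\<theta> $ j))"

definition col_sums :: "real ^ 'n ^ 'm \<Rightarrow> real ^ 'n" where
  "col_sums A = (\<chi> j. \<Sum>i\<in>UNIV. A $ i $ j)"

definition exp_potential :: "real ^ 'n ^ 'm \<Rightarrow> real ^ 'n \<Rightarrow> ereal" where
  "exp_potential A \<theta> = ereal (\<Sum>i\<in>UNIV. \<Sum>j\<in>UNIV. A $ i $ j * exp (\<theta> $ j))"

definition log_barrier :: "real ^ 'n \<Rightarrow> real ^ 'n \<Rightarrow> ereal" where
  "log_barrier w x =
     (if x \<in> pos_orthant then ereal (- (\<Sum>j\<in>UNIV. w $ j * ln (x $ j))) else \<infinity>)"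

definition bregman_proj ::
    "(real ^ 'n \<Rightarrow> ereal) \<Rightarrow> (real ^ 'n) set \<Rightarrow> real ^ 'n \<Rightarrow> (real ^ 'n) set" where
  "bregman_proj \<phi> C y = bregman_argmin \<phi> (C \<inter> pos_orthant) y"

end

theory Submission
  imports Defs
begin

text \<open>
  Write the first argument as \<open>\<theta>\<close>, the base point as \<open>\<eta>\<close> and \<open>w\<close> for the column sums of \<open>A\<close>.
  Because the weights of the barrier are \<open>w\<^sub>j exp \<eta>\<^sub>j\<close>, both its divergence between
  \<open>exp \<theta>\<close> and \<open>exp \<eta>\<close> and the divergence of the exponential potential between \<open>\<theta>\<close> and \<open>\<eta>\<close>
  equal \<open>\<Sum>\<^sub>j w\<^sub>j (exp \<theta>\<^sub>j - exp \<eta>\<^sub>j - exp \<eta>\<^sub>j (\<theta>\<^sub>j - \<eta>\<^sub>j))\<close>. Hence the componentwise exponential,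
  a bijection onto the positive orthant, carries minimizers to minimizers.
\<close>

text \<open>The description in \<open>gradient\<close> has a value because Frechet derivatives are
  unique and inner products with all \<open>h\<close> determine a vector.\<close>

lemma gradient_eqI:
  assumes "GDERIV f y :> D"
  shows "gradient f y = D"
  unfolding gradient_def
proof (rule the_equality)
  fix D' assume "GDERIV f y :> D'"
  with assms have "(\<lambda>h. h \<bullet> D') = (\<lambda>h. h \<bullet> D)"
    unfolding gderiv_def using has_derivative_unique by blast
  then show "D' = D"
    by (metis vector_eq_ldot)
qed (fact assms)

lemma open_pos_orthant: "open (pos_orthant :: (real ^ 'n) set)"
  unfolding pos_orthant_def Collect_all_eq
  by (intro open_INT finite ballI open_Collect_less continuous_intros)

lemma vec_exp_pos: "vec_exp \<theta> \<in> pos_orthant"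
  by (simp add: vec_exp_def pos_orthant_def)

lemma inj_vec_exp: "inj vec_exp"
  by (rule injI) (simp add: vec_exp_def vec_eq_iff)

text \<open>Logarithms give preimages; this presents the feasible set of the barrier problem as the
  image of \<open>C\<^sub>\<theta>\<close>.\<close>

lemma image_vec_exp_vimage: "vec_exp ` (vec_exp -` C) = C \<inter> pos_orthant"
proof -
  have "x \<in> range vec_exp" if "x \<in> pos_orthant" for x :: "real ^ 'n"
  proof
    show "x = vec_exp (\<chi> j. ln (x $ j))"
      using that by (simp add: vec_exp_def pos_orthant_def vec_eq_iff)
  qed simp
  then show ?thesis
    using vec_exp_pos by auto
qed

lemma exp_potential_eq:
  "exp_potential A \<theta> = ereal (\<Sum>j\<in>UNIV. col_sums A $ j * exp (\<theta> $ j))"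
  unfolding exp_potential_def col_sums_def
  by (subst sum.swap) (simp add: sum_distrib_right)

lemma gradient_exp_potential:
  "gradient (\<lambda>z. real_of_ereal (exp_potential A z)) \<theta> = (\<chi> j. col_sums A $ j * exp (\<theta> $ j))"
proof (rule gradient_eqI)
  show "GDERIV (\<lambda>z. real_of_ereal (exp_potential A z)) \<theta> :> (\<chi> j. col_sums A $ j * exp (\<theta> $ j))"
    unfolding gderiv_def exp_potential_eq real_of_ereal.simps
    by (auto intro!: derivative_eq_intros sum.cong
        bounded_linear_imp_has_derivative[OF bounded_linear_vec_nth] simp: inner_vec_def fun_eq_iff)
qed

lemma gradient_log_barrier:
  assumes "y \<in> pos_orthant"
  shows "gradient (\<lambda>z. real_of_ereal (log_barrier w z)) y = (\<chi> j. - (w $ j / y $ j))"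
proof (rule gradient_eqI)
  have nz: "0 < y $ j" for j
    using assms by (simp add: pos_orthant_def)
  have "((\<lambda>z. - (\<Sum>j\<in>UNIV. w $ j * ln (z $ j))) has_derivative
      (\<lambda>h. h \<bullet> (\<chi> j. - (w $ j / y $ j)))) (at y)"
    by (auto intro!: derivative_eq_intros sum.cong
        bounded_linear_imp_has_derivative[OF bounded_linear_vec_nth] nz
        simp: inner_vec_def fun_eq_iff sum_negf[symmetric] divide_inverse)
  \<comment> \<open>Outside the orthant \<open>real_of_ereal\<close> turns \<infinity> into 0, so
    the formula transfers only locally, by openness.\<close>
  then have "((\<lambda>z. real_of_ereal (log_barrier w z)) has_derivative
      (\<lambda>h. h \<bullet> (\<chi> j. - (w $ j / y $ j)))) (at y)"
    by (rule has_derivative_transform_within_open[OF _ open_pos_orthant assms])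
       (simp add: log_barrier_def)
  then show "GDERIV (\<lambda>z. real_of_ereal (log_barrier w z)) y :> (\<chi> j. - (w $ j / y $ j))"
    by (simp add: gderiv_def)
qed

lemma bregman_div_log_barrier_vec_exp:
  "bregman_div (log_barrier (\<chi> j. col_sums A $ j * vec_exp \<eta> $ j)) (vec_exp \<theta>) (vec_exp \<eta>) =
    bregman_div (exp_potential A) \<theta> \<eta>"
proof -
  \<comment> \<open>Cancelling this factor reduces the barrier gradient to
    \<open>- col_sums A\<close>.\<close>
  have "vec_exp \<eta> $ j \<noteq> 0" for j
    by (simp add: vec_exp_def)
  then show ?thesis
    unfolding bregman_div_def gradient_exp_potential gradient_log_barrier[OF vec_exp_pos]
    by (simp add: exp_potential_eq log_barrier_def vec_exp_pos)
       (simp add: inner_vec_def vec_exp_def sum_negf sum_subtractf[symmetric]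
         sum.distrib[symmetric] algebra_simps)
qed

text \<open>Minimality over the image compares only values at points \<open>g \<theta>\<close>,
  which match those at \<open>\<theta>\<close>.\<close>

lemma bregman_argmin_image:
  assumes "\<And>\<theta>. bregman_div v (g \<theta>) (g \<eta>) = bregman_div u \<theta> \<eta>"
  shows "bregman_argmin v (g ` S) (g \<eta>) = g ` bregman_argmin u S \<eta>"
  using assms by (auto simp: bregman_argmin_def is_arg_min_def)

theorem proposition9:
  fixes A :: "real ^ 'n ^ 'm"
    and C C\<^sub>\<theta> :: "(real ^ 'n) set"
    and \<theta>_tilde \<theta>_star x_tilde x_star w w_tilde :: "real ^ 'n"
    and \<phi> :: "real ^ 'n \<Rightarrow> ereal"
  assumes "\<And>i j. 0 \<le> A $ i $ j"
    and "w = col_sums A"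
    and "\<And>j. 0 < w $ j"
    and "convex C"
    and "C \<inter> pos_orthant \<noteq> {}"
    and "C\<^sub>\<theta> = {\<theta>. vec_exp \<theta> \<in> C}"
    and "closed C\<^sub>\<theta>"
    and "convex C\<^sub>\<theta>"
    and "x_star = vec_exp \<theta>_star"
    and "x_tilde = vec_exp \<theta>_tilde"
    and "w_tilde = (\<chi> j. w $ j * x_tilde $ j)"
    and "\<phi> = log_barrier w_tilde"
  shows "(\<theta>_star \<in> bregman_argmin (exp_potential A) C\<^sub>\<theta> \<theta>_tilde \<longleftrightarrow>
            x_star \<in> bregman_proj \<phi> C x_tilde) \<and>
         (bregman_argmin (exp_potential A) C\<^sub>\<theta> \<theta>_tilde = {\<theta>_star} \<longleftrightarrow>
            bregman_proj \<phi> C x_tilde = {x_star})"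
proof -
  have "C\<^sub>\<theta> = vec_exp -` C"
    using assms(6) by auto
  then have "bregman_proj \<phi> C x_tilde =
      vec_exp ` bregman_argmin (exp_potential A) C\<^sub>\<theta> \<theta>_tilde"
    unfolding bregman_proj_def assms(2,10-12) image_vec_exp_vimage[symmetric]
    by (simp only: bregman_argmin_image bregman_div_log_barrier_vec_exp)
  then show ?thesis
    \<comment> \<open>Injectivity reflects membership and, as \<open>{x_star}\<close> is the image
      of \<open>{\<theta>_star}\<close>, uniqueness.\<close>
    using inj_image_mem_iff[OF inj_vec_exp, of \<theta>_star]
      inj_image_eq_iff[OF inj_vec_exp, of _ "{\<theta>_star}"] assms(9)
    by simp
qed

end
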